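(* Let $x_0=1$, let $\mu^{\rm a}$ be an atomless probability measure on $\mathbb{R}_+$ with finite first moment and mean $x_0$, let $K>x_0$ and $h(x)=\mathbf{1}_{\{x\ge K\}}$. Let $L^\star\le K$ be such that $b^{\rm a}(L^\star)=0$, where $b^{\rm a}(L)=\int_L^\infty(x-K)\,\mu^{\rm a}(dx)$, and assume $L^\star<K$. For $L<K$ set $\psi_L(x)=\frac{1}{K-L}(x-L)^+$. Let $$P(h)=\sup_{\mu\in\underline{\mathcal{Q}}(\mu^{\rm a})}\mu([K,\infty)),\qquad D(h)=\inf_{(\psi^{\rm a},\psi^{\rm b})\in\Psi^{\rm b,a}(h)}\big(\mu^{\rm a}(\psi^{\rm a})-\psi^{\rm b}(x_0)\big).$$ Then: (i) $\mu^\star:=\mu^{\rm a}\big|_{[0,L^\star]}+\mu^{\rm a}([L^\star,\infty))\,\delta_K$ belongs to $\underline{\mathcal{Q}}(\mu^{\rm a})$ and attains the supremum defining $P(h)$. (ii) $(\psi_{L^\star},0)$ belongs to $\Psi^{\rm b,a}(h)$ and attains the infimum defining $D(h)$. (iii) $P(h)=D(h)=\dfrac{c^{\rm a}(L^\star)}{K-L^\star}=\mu^{\rm a}([L^\star,\infty))$, where $c^{\rm a}(L)=\int(x-L)^+\,\mu^{\rm a}(dx)$.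
   Context: $\mathbb{R}_+=[0,\infty)$; $\mu(f)=\int f\,d\mu$; $\delta_y$ is the Dirac mass at $y$; $\mu|_A$ is the restriction of the measure $\mu$ to $A$. $\mathrm{CVX}_L$ is the set of continuous convex functions $\psi:\mathbb{R}_+\to\mathbb{R}$ with linear growth ($\sup_x|\psi(x)|/(1+|x|)<\infty$). For probability measures $\mu,\nu$ on $\mathbb{R}_+$ with finite first moment, $\mu\preceq_{\rm cx}\nu$ means $\mu(\psi)\le\nu(\psi)$ for all $\psi\in\mathrm{CVX}_L$. $\underline{\mathcal{Q}}(\mu^{\rm a})$ is the set of probability measures $\mu$ on $\mathbb{R}_+$ with finite first moment and $\mu\preceq_{\rm cx}\mu^{\rm a}$. $\Psi^{\rm b,a}(h)=\{(\psi^{\rm a},\psi^{\rm b})\in\mathrm{CVX}_L^2:\psi^{\rm a}-\psi^{\rm b}\ge h\text{ on }\mathbb{R}_+\}$. (This is the one-sided market in which the bid marginal is $\delta_{x_0}$. A number $L^\star\in[0,K]$ with $b^{\rm a}(L^\star)=0$ exists since $b^{\rm a}$ is continuous, $b^{\rm a}(0)<0$ and $b^{\rm a}(K)\ge0$.) *)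

theory Defs
  imports "HOL-Probability.Probability"
begin

text \<open>Measures on the half-line are measures whose sigma-algebra is the Borel
  sigma-algebra of \<open>[0, \<infinity>)\<close>, so that \<open>space \<mu> = {0..}\<close>. Functions on the half-line
  are represented by total functions of which only the values on \<open>{0..}\<close> matter.\<close>

definition borel_pos :: "real measure" where
  "borel_pos = restrict_space borel {0..}"

definition prob_measures :: "real measure set" where
  "prob_measures = {\<mu>. sets \<mu> = sets borel_pos \<and> prob_space \<mu> \<and> integrable \<mu> (\<lambda>x. x)}"

definition atomless :: "real measure \<Rightarrow> bool" where
  "atomless \<mu> \<longleftrightarrow> (\<forall>x\<in>space \<mu>. emeasure \<mu> {x} = 0)"

definition CVX\<^sub>L :: "(real \<Rightarrow> real) set" where
  "CVX\<^sub>L = {\<psi>. continuous_on {0..} \<psi> \<and> convex_on {0..} \<psi> \<and>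
              bdd_above ((\<lambda>x. \<bar>\<psi> x\<bar> / (1 + \<bar>x\<bar>)) ` {0..})}"

definition convex_order :: "real measure \<Rightarrow> real measure \<Rightarrow> bool" (infix "\<preceq>\<^sub>c\<^sub>x" 50) where
  "\<mu> \<preceq>\<^sub>c\<^sub>x \<nu> \<longleftrightarrow> (\<forall>\<psi>\<in>CVX\<^sub>L. (\<integral>x. \<psi> x \<partial>\<mu>) \<le> (\<integral>x. \<psi> x \<partial>\<nu>))"

definition Q_ask :: "real measure \<Rightarrow> real measure set" where
  "Q_ask \<mu>a = {\<mu> \<in> prob_measures. \<mu> \<preceq>\<^sub>c\<^sub>x \<mu>a}"

definition \<Psi>_ba :: "(real \<Rightarrow> real) \<Rightarrow> ((real \<Rightarrow> real) \<times> (real \<Rightarrow> real)) set" where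
  "\<Psi>_ba h = {(\<psi>a, \<psi>b). \<psi>a \<in> CVX\<^sub>L \<and> \<psi>b \<in> CVX\<^sub>L \<and> (\<forall>x\<ge>0. \<psi>a x - \<psi>b x \<ge> h x)}"

definition digital :: "real \<Rightarrow> real \<Rightarrow> real" where
  "digital K x = (if x \<ge> K then 1 else 0)"

text \<open>The optimal values are taken in the extended reals, where suprema and infima of
  arbitrary sets have their usual meaning (on \<^typ>\<open>real\<close> they are unspecified for
  unbounded or empty sets).\<close>

definition primal_value :: "real measure \<Rightarrow> real \<Rightarrow> ereal" where
  "primal_value \<mu>a K = (SUP \<mu>\<in>Q_ask \<mu>a. ereal (measure \<mu> {K..}))"

definition dual_cost :: "real measure \<Rightarrow> real \<Rightarrow> (real \<Rightarrow> real) \<times> (real \<Rightarrow> real) \<Rightarrow> real" where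
  "dual_cost \<mu>a x0 = (\<lambda>(\<psi>a, \<psi>b). (\<integral>x. \<psi>a x \<partial>\<mu>a) - \<psi>b x0)"

definition dual_value :: "real measure \<Rightarrow> real \<Rightarrow> (real \<Rightarrow> real) \<Rightarrow> ereal" where
  "dual_value \<mu>a x0 h = (INF p\<in>\<Psi>_ba h. ereal (dual_cost \<mu>a x0 p))"

definition b_ask :: "real measure \<Rightarrow> real \<Rightarrow> real \<Rightarrow> real" where
  "b_ask \<mu>a K L = (LINT x:{L..}|\<mu>a. x - K)"

definition c_ask :: "real measure \<Rightarrow> real \<Rightarrow> real" where
  "c_ask \<mu>a L = (\<integral>x. max (x - L) 0 \<partial>\<mu>a)"

definition scaled_call :: "real \<Rightarrow> real \<Rightarrow> real \<Rightarrow> real" where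
  "scaled_call K L x = 1 / (K - L) * max (x - L) 0"

definition add_measure :: "'a measure \<Rightarrow> 'a measure \<Rightarrow> 'a measure" where
  "add_measure M N = measure_of (space M) (sets M) (\<lambda>A. emeasure M A + emeasure N A)"

text \<open>The restriction of \<open>\<mu>a\<close> to \<open>[0, L]\<close> is taken as a measure on the whole half-line,
  i.e. \<open>A \<mapsto> \<mu>a (A \<inter> [0, L])\<close>; this is \<^const>\<open>density\<close> with an indicator and not
  \<^const>\<open>restrict_space\<close>.\<close>

definition \<mu>_opt :: "real measure \<Rightarrow> real \<Rightarrow> real \<Rightarrow> real measure" where
  "\<mu>_opt \<mu>a K L = add_measure (density \<mu>a (indicator {0..L}))
                     (scale_measure (emeasure \<mu>a {L..}) (return borel_pos K))"

end

theory Submission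
  imports Defs
begin

text \<open>The map sending \<open>[L, \<infinity>)\<close> to the single point \<open>K\<close> and fixing the rest pushes
  \<open>\<mu>a\<close> forward to \<open>\<mu>_opt\<close>. Since \<open>b_ask \<mu>a K L = 0\<close> says that \<open>K\<close> is the barycentre of \<open>\<mu>a\<close> on
  \<open>[L, \<infinity>)\<close>, a supporting line at \<open>K\<close> shows that this push-forward decreases in convex order,
  and the same equation gives \<open>c_ask \<mu>a L = (K - L) * measure \<mu>a {L..}\<close>. Hence the primal
  candidate and the dual candidate have equal values, and weak duality (Jensen's inequality at
  the common mean \<open>x0\<close>) makes both optimal.\<close>

section \<open>Measurability and integrability on the half-line\<close>

lemma space_borel_pos [simp]: "space borel_pos = {0..}"
  by (simp add: borel_pos_def space_restrict_space)

lemma sets_borel_pos_iff: "A \<in> sets borel_pos \<longleftrightarrow> A \<subseteq> {0..} \<and> A \<in> sets borel"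
  by (simp add: borel_pos_def sets_restrict_space_iff)

lemma space_prob_measures: "\<mu> \<in> prob_measures \<Longrightarrow> space \<mu> = {0..}"
  using sets_eq_imp_space_eq[of \<mu> borel_pos] by (simp add: prob_measures_def)

lemma borel_measurable_prob_measures:
  assumes "\<mu> \<in> prob_measures"
  shows "borel_measurable \<mu> = borel_measurable borel_pos"
  using assms by (intro measurable_cong_sets refl) (simp add: prob_measures_def)

lemma borel_measurable_CVX:
  assumes "\<psi> \<in> CVX\<^sub>L"
  shows "\<psi> \<in> borel_measurable borel_pos"
  unfolding borel_pos_def
  using assms by (intro borel_measurable_continuous_on_restrict) (simp add: CVX\<^sub>L_def)

lemma CVX_linear_growth:
  assumes "\<psi> \<in> CVX\<^sub>L"
  obtains C where "\<And>x. x \<ge> 0 \<Longrightarrow> \<bar>\<psi> x\<bar> \<le> C * (1 + x)"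
proof -
  from assms obtain C where C: "\<And>x. x \<ge> 0 \<Longrightarrow> \<bar>\<psi> x\<bar> / (1 + \<bar>x\<bar>) \<le> C"
    by (auto simp: CVX\<^sub>L_def bdd_above_def)
  show thesis
  proof (rule that)
    fix x :: real assume "x \<ge> 0"
    with C[of x] show "\<bar>\<psi> x\<bar> \<le> C * (1 + x)"
      by (simp add: divide_le_eq)
  qed
qed

lemma integrable_CVX:
  assumes "\<mu> \<in> prob_measures" "\<psi> \<in> CVX\<^sub>L"
  shows "integrable \<mu> \<psi>"
proof -
  interpret prob_space \<mu> using assms by (simp add: prob_measures_def)
  obtain C where C: "\<And>x. x \<ge> 0 \<Longrightarrow> \<bar>\<psi> x\<bar> \<le> C * (1 + x)"
    using CVX_linear_growth assms(2) by blast
  show ?thesis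
  proof (rule Bochner_Integration.integrable_bound)
    show "integrable \<mu> (\<lambda>x. C * (1 + x))"
      using assms by (auto simp: prob_measures_def)
    show "\<psi> \<in> borel_measurable \<mu>"
      using assms by (simp add: borel_measurable_prob_measures borel_measurable_CVX)
    show "AE x in \<mu>. norm (\<psi> x) \<le> norm (C * (1 + x))"
      using C by (intro AE_I2) (force simp: space_prob_measures[OF assms(1)])
  qed
qed

section \<open>Members of \<open>CVX\<^sub>L\<close>\<close>

lemma CVX_I:
  assumes "continuous_on {0..} \<psi>" "convex_on {0..} \<psi>"
    and bound: "\<And>x. x \<ge> 0 \<Longrightarrow> \<bar>\<psi> x\<bar> \<le> C * (1 + x)"
  shows "\<psi> \<in> CVX\<^sub>L"
proof -
  have "\<bar>\<psi> x\<bar> / (1 + \<bar>x\<bar>) \<le> C" if "x \<in> {0..}" for x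
    using that bound[of x] by (simp add: divide_le_eq)
  then have "bdd_above ((\<lambda>x. \<bar>\<psi> x\<bar> / (1 + \<bar>x\<bar>)) ` {0..})"
    by (rule bdd_aboveI2)
  with assms(1,2) show ?thesis
    by (simp add: CVX\<^sub>L_def)
qed

text \<open>Slopes 1 and -1 later force equal means under the convex order; slope 0 supplies the
  zero function as bid component of the dual candidate.\<close>

lemma CVX_affine: "(\<lambda>x. a * x + b) \<in> CVX\<^sub>L"
proof (rule CVX_I)
  show "\<bar>a * x + b\<bar> \<le> (\<bar>a\<bar> + \<bar>b\<bar>) * (1 + x)" if "x \<ge> 0" for x
  proof -
    have "\<bar>a * x + b\<bar> \<le> \<bar>a\<bar> * x + \<bar>b\<bar>"
      using that abs_triangle_ineq[of "a * x" b] by (simp add: abs_mult)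
    moreover have "0 \<le> \<bar>b\<bar> * x" using that by simp
    ultimately show ?thesis unfolding distrib_left distrib_right by linarith
  qed
  show "convex_on {0..} (\<lambda>x. a * x + b)"
    by (rule convex_onI) (auto simp: algebra_simps)
qed (intro continuous_intros)

lemma CVX_scaled_call:
  assumes "L < K"
  shows "scaled_call K L \<in> CVX\<^sub>L"
proof (rule CVX_I)
  have "convex_on {0..} (\<lambda>x. max (x - L) 0)"
  proof (rule convex_onI)
    fix t x y :: real assume t: "t > 0" "t < 1"
    have "(1 - t) * (x - L) + t * (y - L) \<le> (1 - t) * max (x - L) 0 + t * max (y - L) 0"
      using t by (intro add_mono mult_left_mono) auto
    moreover have "0 \<le> (1 - t) * max (x - L) 0 + t * max (y - L) 0"
      using t by (intro add_nonneg_nonneg mult_nonneg_nonneg) auto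
    moreover have "(1 - t) *\<^sub>R x + t *\<^sub>R y - L = (1 - t) * (x - L) + t * (y - L)"
      by (simp add: algebra_simps)
    ultimately show "max ((1 - t) *\<^sub>R x + t *\<^sub>R y - L) 0 \<le> (1 - t) * max (x - L) 0 + t * max (y - L) 0"
      by (simp only: max.bounded_iff)
  qed simp
  then show "convex_on {0..} (scaled_call K L)"
    unfolding scaled_call_def using assms by (intro convex_on_cmul) auto
  show "continuous_on {0..} (scaled_call K L)"
    unfolding scaled_call_def by (intro continuous_intros)
  show "\<bar>scaled_call K L x\<bar> \<le> 1 / (K - L) * (1 + \<bar>L\<bar>) * (1 + x)" if "x \<ge> 0" for x
  proof -
    \<comment> \<open>The cross term of the product (1 + |L|) * (1 + x); the remaining terms already
      dominate x + |L|, hence the call payoff.\<close>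
    have "0 \<le> \<bar>L\<bar> * x" using that by simp
    then have "max (x - L) 0 \<le> (1 + \<bar>L\<bar>) * (1 + x)"
      using that unfolding distrib_left distrib_right by linarith
    then have "1 / (K - L) * max (x - L) 0 \<le> 1 / (K - L) * ((1 + \<bar>L\<bar>) * (1 + x))"
      using assms by (intro mult_left_mono) auto
    moreover have "scaled_call K L x \<ge> 0"
      using assms by (simp add: scaled_call_def)
    ultimately show ?thesis
      by (simp only: scaled_call_def abs_of_nonneg mult.assoc)
  qed
qed

section \<open>Supporting lines and weak duality\<close>

lemma CVX_supporting_line:
  assumes "\<psi> \<in> CVX\<^sub>L" "p > 0"
  obtains c where "\<And>x. x \<ge> 0 \<Longrightarrow> \<psi> p + c * (x - p) \<le> \<psi> x"
proof -
  have "convex_on {0..} \<psi>" "p \<in> interior {0..}"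
    using assms by (simp_all add: CVX\<^sub>L_def)
  \<comment> \<open>The slope is the infimum of the difference quotients to the right of
    \<open>p\<close>. At the boundary point 0 it could be minus infinity, as for minus the square
    root, which lies in \<open>CVX\<^sub>L\<close>.\<close>
  from convex_le_Inf_differential[OF this] show thesis
    by (intro that) simp
qed

text \<open>Integrate the supporting line at the mean: its linear term vanishes. A positive mean is
  an interior point, where such a line exists.\<close>

lemma jensen_CVX:
  assumes "\<mu> \<in> prob_measures" "\<psi> \<in> CVX\<^sub>L" "(\<integral>x. x \<partial>\<mu>) > 0"
  shows "\<psi> (\<integral>x. x \<partial>\<mu>) \<le> (\<integral>x. \<psi> x \<partial>\<mu>)"
proof -
  interpret prob_space \<mu> using assms by (simp add: prob_measures_def)
  define m where "m = (\<integral>x. x \<partial>\<mu>)"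
  obtain c where c: "\<And>x. x \<ge> 0 \<Longrightarrow> \<psi> m + c * (x - m) \<le> \<psi> x"
    using CVX_supporting_line assms(2,3) unfolding m_def by blast
  have int: "integrable \<mu> (\<lambda>x. x)" using assms by (simp add: prob_measures_def)
  have "\<psi> m = (\<integral>x. \<psi> m + c * (x - m) \<partial>\<mu>)"
    using int by (simp add: m_def prob_space)
  also have "\<dots> \<le> (\<integral>x. \<psi> x \<partial>\<mu>)"
    using int c assms
    by (intro integral_mono) (auto simp: integrable_CVX space_prob_measures)
  finally show ?thesis by (simp add: m_def)
qed

text \<open>Both x and -x are test functions of the convex order, so the inequality holds in both
  directions.\<close>

lemma Q_ask_mean:
  assumes "\<mu> \<in> Q_ask \<mu>a"
  shows "(\<integral>x. x \<partial>\<mu>) = (\<integral>x. x \<partial>\<mu>a)"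
proof -
  have "(\<integral>x. a * x + 0 \<partial>\<mu>) \<le> (\<integral>x. a * x + 0 \<partial>\<mu>a)" for a
    using assms CVX_affine[of a 0] unfolding Q_ask_def convex_order_def by blast
  from this[of 1] this[of "-1"] show ?thesis by simp
qed

text \<open>Integrate the superhedging inequality against \<open>\<mu>\<close>. The ask leg is then
  bounded by convex order. The bid leg is bounded by Jensen, because \<open>\<mu>\<close> has mean
  \<open>x0\<close>, so the Dirac mass at \<open>x0\<close> lies below it.\<close>

lemma weak_duality:
  assumes \<mu>a: "\<mu>a \<in> prob_measures" "(\<integral>x. x \<partial>\<mu>a) = x0" "x0 > 0" and K: "K \<ge> 0"
    and \<mu>: "\<mu> \<in> Q_ask \<mu>a" and p: "p \<in> \<Psi>_ba (digital K)"
  shows "measure \<mu> {K..} \<le> dual_cost \<mu>a x0 p"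
proof -
  obtain \<psi>a \<psi>b where p_eq: "p = (\<psi>a, \<psi>b)" by (cases p)
  with p have \<psi>: "\<psi>a \<in> CVX\<^sub>L" "\<psi>b \<in> CVX\<^sub>L" "\<And>x. x \<ge> 0 \<Longrightarrow> digital K x \<le> \<psi>a x - \<psi>b x"
    by (auto simp: \<Psi>_ba_def)
  have \<mu>': "\<mu> \<in> prob_measures" using \<mu> by (simp add: Q_ask_def)
  interpret prob_space \<mu> using \<mu>' by (simp add: prob_measures_def)
  have K_sets: "{K..} \<in> sets \<mu>"
    using \<mu>' K by (auto simp: prob_measures_def sets_borel_pos_iff)
  have "measure \<mu> {K..} = (\<integral>x. indicator {K..} x \<partial>\<mu>)"
    using sets.sets_into_space[OF K_sets] by (simp add: Int_absorb2)
  also have "\<dots> \<le> (\<integral>x. \<psi>a x - \<psi>b x \<partial>\<mu>)"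
  proof (intro integral_mono)
    show "integrable \<mu> (indicator {K..} :: real \<Rightarrow> real)"
      using K_sets by (simp add: emeasure_eq_measure)
    show "integrable \<mu> (\<lambda>x. \<psi>a x - \<psi>b x)"
      using \<mu>' \<psi> by (simp add: integrable_CVX)
    show "indicator {K..} x \<le> \<psi>a x - \<psi>b x" if "x \<in> space \<mu>" for x
      using that \<psi>(3)[of x] space_prob_measures[OF \<mu>'] by (auto simp: digital_def indicator_def)
  qed
  also have "\<dots> = (\<integral>x. \<psi>a x \<partial>\<mu>) - (\<integral>x. \<psi>b x \<partial>\<mu>)"
    using \<mu>' \<psi> by (simp add: integrable_CVX)
  also have "\<dots> \<le> (\<integral>x. \<psi>a x \<partial>\<mu>a) - \<psi>b x0"
    using \<mu> \<psi> jensen_CVX[OF \<mu>' \<psi>(2)] Q_ask_mean[OF \<mu>] \<mu>a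
    by (intro diff_mono) (auto simp: Q_ask_def convex_order_def)
  finally show ?thesis by (simp add: p_eq dual_cost_def)
qed

section \<open>The primal candidate as a push-forward\<close>

definition collapse :: "real \<Rightarrow> real \<Rightarrow> real \<Rightarrow> real" where
  "collapse K L x = (if x < L then x else K)"

lemma measurable_collapse:
  assumes "\<mu> \<in> prob_measures" "K \<ge> 0"
  shows "collapse K L \<in> measurable \<mu> borel_pos"
proof -
  have "collapse K L \<in> borel_measurable borel"
    unfolding collapse_def by measurable
  then have "collapse K L \<in> borel_measurable \<mu>"
    by (simp add: borel_measurable_prob_measures[OF assms(1)] borel_pos_def measurable_restrict_space1)
  then show ?thesis
    unfolding borel_pos_def
    using assms(2) by (intro measurable_restrict_space2)
      (auto simp: collapse_def space_prob_measures[OF assms(1)])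
qed

text \<open>\<open>\<mu>_opt\<close> counts the point \<open>L\<close> twice, once in the
  restriction to \<open>{0..L}\<close> and once in the mass moved to \<open>K\<close>, while
  \<open>collapse\<close> only moves it. The two agree because an atomless measure does not charge
  \<open>{L}\<close>.\<close>

lemma \<mu>_opt_eq_distr:
  assumes \<mu>a: "\<mu>a \<in> prob_measures" "atomless \<mu>a" and L: "L \<ge> 0" and K: "K \<ge> 0"
  shows "\<mu>_opt \<mu>a K L = distr \<mu>a borel_pos (collapse K L)"
proof -
  have sets: "sets \<mu>a = sets borel_pos" and space: "space \<mu>a = {0..}"
    using \<mu>a by (auto simp: prob_measures_def space_prob_measures)
  have emeasure: "emeasure (density \<mu>a (indicator {0..L})) A +
      emeasure (scale_measure (emeasure \<mu>a {L..}) (return borel_pos K)) A =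
      emeasure (distr \<mu>a borel_pos (collapse K L)) A" if A: "A \<in> sets borel_pos" for A
  proof -
    have mA: "A \<in> sets \<mu>a" and mi: "{0..L} \<in> sets \<mu>a" and ml: "{0..<L} \<in> sets \<mu>a"
      and ms: "{L..} \<in> sets \<mu>a" and mL: "{L} \<in> sets \<mu>a"
      using A L by (auto simp: sets sets_borel_pos_iff)
    have A_sub: "A \<subseteq> {0..}" using A by (simp add: sets_borel_pos_iff)
    have null: "{L} \<in> null_sets \<mu>a"
      using \<mu>a(2) L space mL by (auto simp: atomless_def null_sets_def)
    have "emeasure (density \<mu>a (indicator {0..L})) A = (\<integral>\<^sup>+x. indicator (A \<inter> {0..L}) x \<partial>\<mu>a)"
      using mA mi by (simp add: emeasure_density indicator_inter_arith mult.commute)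
    also have "\<dots> = emeasure \<mu>a (A \<inter> {0..L})"
      using mA mi by (intro nn_integral_indicator) auto
    also have "\<dots> = emeasure \<mu>a (A \<inter> {0..<L})"
    proof (rule emeasure_eq_AE)
      show "AE x in \<mu>a. (x \<in> A \<inter> {0..L}) = (x \<in> A \<inter> {0..<L})"
        using AE_not_in[OF null] by eventually_elim auto
    qed (use mA mi ml in auto)
    finally have 1: "emeasure (density \<mu>a (indicator {0..L})) A = emeasure \<mu>a (A \<inter> {0..<L})" .
    have "collapse K L -` A \<inter> space \<mu>a = A \<inter> {0..<L} \<union> (if K \<in> A then {L..} else {})"
      using A_sub L by (auto simp: space collapse_def split: if_splits)
    then have "emeasure (distr \<mu>a borel_pos (collapse K L)) A =
        emeasure \<mu>a (A \<inter> {0..<L} \<union> (if K \<in> A then {L..} else {}))"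
      using A measurable_collapse[OF \<mu>a(1) K] by (simp add: emeasure_distr)
    also have "\<dots> = emeasure \<mu>a (A \<inter> {0..<L}) + emeasure \<mu>a (if K \<in> A then {L..} else {})"
      using mA ml ms by (intro plus_emeasure[symmetric]) auto
    finally show ?thesis
      using 1 A by (simp add: indicator_def)
  qed
  let ?D = "distr \<mu>a borel_pos (collapse K L)"
  \<comment> \<open>\<open>measure_of\<close> returns the zero measure when its set function is not
    countably additive. Agreement with a genuine measure on all measurable sets rules out this
    default.\<close>
  have "\<mu>_opt \<mu>a K L = measure_of (space ?D) (sets ?D) (emeasure ?D)"
    unfolding \<mu>_opt_def add_measure_def
    using emeasure sets.space_closed[of borel_pos]
    by (simp add: space sets, intro measure_of_eq)
      (auto simp flip: space_borel_pos simp: sets.sigma_sets_eq)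
  then show ?thesis by (simp only: measure_of_of_measure)
qed

section \<open>Optimality of both candidates\<close>

theorem proposition5p1:
  fixes \<mu>a :: "real measure" and x0 K L :: real and h :: "real \<Rightarrow> real"
  assumes "x0 = 1"
    and "\<mu>a \<in> prob_measures" and "atomless \<mu>a" and "(\<integral>x. x \<partial>\<mu>a) = x0"
    and "K > x0" and "h = digital K"
    and "L \<le> K" and "b_ask \<mu>a K L = 0" and "L < K"
  shows
    "(\<mu>_opt \<mu>a K L \<in> Q_ask \<mu>a \<and>
      ereal (measure (\<mu>_opt \<mu>a K L) {K..}) = primal_value \<mu>a K) \<and>
     ((scaled_call K L, \<lambda>_. 0) \<in> \<Psi>_ba h \<and>
      ereal (dual_cost \<mu>a x0 (scaled_call K L, \<lambda>_. 0)) = dual_value \<mu>a x0 h) \<and>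
     (primal_value \<mu>a K = dual_value \<mu>a x0 h \<and>
      dual_value \<mu>a x0 h = ereal (c_ask \<mu>a L / (K - L)) \<and>
      c_ask \<mu>a L / (K - L) = measure \<mu>a {L..})"
proof -
  note x0 = assms(1) and \<mu>a = assms(2) and atomless = assms(3) and mean = assms(4)
    and K = assms(5) and h = assms(6) and b = assms(8) and LK = assms(9)
  interpret prob_space \<mu>a using \<mu>a by (simp add: prob_measures_def)
  have int: "integrable \<mu>a (\<lambda>x. x)" and sets: "sets \<mu>a = sets borel_pos"
    and space: "space \<mu>a = {0..}"
    using \<mu>a by (auto simp: prob_measures_def space_prob_measures)
  \<comment> \<open>For negative \<open>L\<close> the tail would be the whole half-line, giving
    \<open>b_ask \<mu>a K L = x0 - K < 0\<close>. This excludes the case in which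
    \<open>{L..}\<close> is not a measurable set and \<open>measure\<close> takes its default value
    0.\<close>
  have "b_ask \<mu>a K L = (\<integral>x. x - K \<partial>\<mu>a)" if "L < 0"
    unfolding b_ask_def set_lebesgue_integral_def
    using that by (intro Bochner_Integration.integral_cong) (auto simp: space)
  then have L: "L \<ge> 0"
    using int mean b K by (force simp: prob_space)
  have K0: "K > 0" using K x0 by simp
  have tail [measurable]: "{L..} \<in> sets \<mu>a" using L by (auto simp: sets sets_borel_pos_iff)
  have tail_int: "integrable \<mu>a (\<lambda>x. indicator {L..} x * (x - a))" for a
    using integrable_mult_indicator[OF tail, of "\<lambda>x. x - a"] int by simp
  have tail_mean: "(\<integral>x. indicator {L..} x * (x - K) \<partial>\<mu>a) = 0"
    using b by (simp add: b_ask_def set_lebesgue_integral_def)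
  have tail_mass: "(\<integral>x. indicator {L..} x \<partial>\<mu>a) = measure \<mu>a {L..}"
    using sets.sets_into_space[OF tail] by (simp add: Int_absorb2)

  \<comment> \<open>Split x - L into (x - K) + (K - L) on the tail; the first part integrates to
    \<open>b_ask\<close>, which is zero.\<close>
  have "c_ask \<mu>a L = (\<integral>x. indicator {L..} x * (x - K) + (K - L) * indicator {L..} x \<partial>\<mu>a)"
    unfolding c_ask_def by (intro Bochner_Integration.integral_cong) (auto simp: indicator_def)
  also have "\<dots> = (\<integral>x. indicator {L..} x * (x - K) \<partial>\<mu>a) + (\<integral>x. (K - L) * indicator {L..} x \<partial>\<mu>a)"
    by (intro Bochner_Integration.integral_add tail_int integrable_mult_right
        integrable_real_indicator) (auto simp: emeasure_eq_measure)
  also have "\<dots> = (K - L) * measure \<mu>a {L..}"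
    by (simp add: tail_mean tail_mass del: integral_indicator)
  finally have c: "c_ask \<mu>a L / (K - L) = measure \<mu>a {L..}"
    using LK by simp

  let ?\<mu> = "\<mu>_opt \<mu>a K L"
  have opt: "?\<mu> = distr \<mu>a borel_pos (collapse K L)"
    using \<mu>a atomless L K0 by (simp add: \<mu>_opt_eq_distr)
  have collapse: "collapse K L \<in> measurable \<mu>a borel_pos"
    using \<mu>a K0 by (simp add: measurable_collapse)
  have id_meas: "(\<lambda>x. x) \<in> borel_measurable borel_pos"
    by (simp add: borel_pos_def measurable_restrict_space1)
  \<comment> \<open>Together with the change of variables, this gives the push-forward a finite
    first moment.\<close>
  have "integrable \<mu>a (collapse K L)"
  proof (rule Bochner_Integration.integrable_bound)
    show "integrable \<mu>a (\<lambda>x. x + K)" using int by simp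
    show "collapse K L \<in> borel_measurable \<mu>a"
      using measurable_compose[OF collapse id_meas] by simp
  qed (use K0 in \<open>auto simp: space collapse_def\<close>)
  then have opt_prob: "?\<mu> \<in> prob_measures"
    using prob_space_distr[OF collapse] collapse id_meas
    by (simp add: prob_measures_def opt integrable_distr_eq)
  have opt_cx: "?\<mu> \<preceq>\<^sub>c\<^sub>x \<mu>a"
    unfolding convex_order_def
  proof
    fix \<psi> assume \<psi>: "\<psi> \<in> CVX\<^sub>L"
    obtain c where c: "\<And>x. x \<ge> 0 \<Longrightarrow> \<psi> K + c * (x - K) \<le> \<psi> x"
      using CVX_supporting_line[OF \<psi> K0] by blast
    have \<psi>_int: "integrable \<mu>a (\<lambda>x. \<psi> (collapse K L x))"
      using integrable_CVX[OF opt_prob \<psi>] collapse borel_measurable_CVX[OF \<psi>]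
      by (simp add: opt integrable_distr_eq)
    have tail_c: "integrable \<mu>a (\<lambda>x. c * (indicator {L..} x * (x - K)))"
      by (intro integrable_mult_right tail_int)
    have "(\<integral>x. \<psi> x \<partial>?\<mu>) = (\<integral>x. \<psi> (collapse K L x) \<partial>\<mu>a)"
      using collapse borel_measurable_CVX[OF \<psi>] by (simp add: opt integral_distr)
    \<comment> \<open>The added term integrates to zero by \<open>tail_mean\<close>. With it the
      comparison becomes pointwise: equality below \<open>L\<close>, and the supporting line at
      \<open>K\<close> from \<open>L\<close> on.\<close>
    also have "\<dots> = (\<integral>x. \<psi> (collapse K L x) + c * (indicator {L..} x * (x - K)) \<partial>\<mu>a)"
      by (subst Bochner_Integration.integral_add[OF \<psi>_int tail_c]) (simp add: tail_mean)
    also have "\<dots> \<le> (\<integral>x. \<psi> x \<partial>\<mu>a)"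
    proof (intro integral_mono)
      show "\<psi> (collapse K L x) + c * (indicator {L..} x * (x - K)) \<le> \<psi> x" if "x \<in> space \<mu>a" for x
        using that c[of x] by (auto simp: space collapse_def indicator_def)
    qed (use \<psi>_int tail_c \<psi> \<mu>a in \<open>auto simp: integrable_CVX\<close>)
    finally show "(\<integral>x. \<psi> x \<partial>?\<mu>) \<le> (\<integral>x. \<psi> x \<partial>\<mu>a)" .
  qed
  have opt_Q: "?\<mu> \<in> Q_ask \<mu>a"
    using opt_prob opt_cx by (simp add: Q_ask_def)
  \<comment> \<open>Points below \<open>L\<close> stay put and, as \<open>L < K\<close>, do not
    reach \<open>K\<close>; all others land on \<open>K\<close>.\<close>
  have "collapse K L -` {K..} \<inter> space \<mu>a = {L..}"
    using L LK by (auto simp: space collapse_def split: if_splits)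
  then have opt_val: "measure ?\<mu> {K..} = measure \<mu>a {L..}"
    using collapse K0 by (subst opt, subst measure_distr) (auto simp: sets_borel_pos_iff)

  have call_\<Psi>: "(scaled_call K L, \<lambda>_. 0) \<in> \<Psi>_ba h"
    using LK CVX_scaled_call[OF LK] CVX_affine[of 0 0]
    by (auto simp: \<Psi>_ba_def h digital_def scaled_call_def le_divide_eq)
  have call_val: "dual_cost \<mu>a x0 (scaled_call K L, \<lambda>_. 0) = measure \<mu>a {L..}"
    using c by (simp add: dual_cost_def scaled_call_def[abs_def] c_ask_def)

  have weak: "measure \<mu> {K..} \<le> dual_cost \<mu>a x0 p" if "\<mu> \<in> Q_ask \<mu>a" "p \<in> \<Psi>_ba h" for \<mu> p
    using weak_duality[OF \<mu>a mean _ _ that(1)] that(2) x0 K0 h by simp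
  \<comment> \<open>Weak duality against the call pair bounds the supremum above, and
    \<open>\<mu>_opt\<close> attains that bound. The dual value follows with the roles
    exchanged.\<close>
  have primal: "primal_value \<mu>a K = ereal (measure \<mu>a {L..})"
    unfolding primal_value_def
    using weak[OF _ call_\<Psi>] call_val opt_val
    by (intro antisym SUP_least SUP_upper2[OF opt_Q]) auto
  have dual: "dual_value \<mu>a x0 h = ereal (measure \<mu>a {L..})"
    unfolding dual_value_def
    using weak[OF opt_Q] call_val opt_val
    by (intro antisym INF_greatest INF_lower2[OF call_\<Psi>]) auto
  show ?thesis
    using opt_Q opt_val call_\<Psi> call_val primal dual c by simp
qed

end
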